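(* Let $n\ge3$, $1\le p<n$, let $\{v_1,\dots,v_p\}$ be an orthonormal family of vectors in $\mathbb{R}^n$, and let $Y=\mu+\sigma\varepsilon$ with $\mu\in\mathbb{R}^n$, $\sigma>0$ and $\varepsilon$ a standard Gaussian vector in $\mathbb{R}^n$. Let $\mathcal M$ be the set of all subsets of $\{1,\dots,p\}$, let $\mathcal S_m=\mathrm{span}\{v_j,\ j\in m\}$ for $m\in\mathcal M$ (with $\mathcal S_\emptyset=\{0\}$), and let $\mathcal S_*=\mathcal S_{\{1,\dots,p\}}$. Let $\alpha>0$, $b\ge 0$, $\beta>0$, and take $$\pi_m=\Big(1+\frac1{p^\alpha}\Big)^{-p}p^{-\alpha|m|},\qquad L_m=b|m|,\qquad m\in\mathcal M.$$ Then the mixed estimator $\hat\mu$ (defined in the context from these $\pi_m$, $L_m$ and $\beta$) is given by $$\hat\mu=\sum_{j=1}^p (c_jZ_j)\,v_j,\qquad Z_j=\langle Y,v_j\rangle,\qquad c_j=\frac{\exp(\beta Z_j^2/\hat\sigma^2)}{p^\alpha\exp(b)+\exp(\beta Z_j^2/\hat\sigma^2)}.$$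
   Context: $\|\cdot\|$ and $\langle\cdot,\cdot\rangle$ are the Euclidean norm and inner product on $\mathbb{R}^n$, $\Pi_{\mathcal S}$ is the orthogonal projector onto $\mathcal S$, and $|m|$ is the cardinality of $m$. Put $\hat\mu_m=\Pi_{\mathcal S_m}Y$ and $\hat\sigma^2=\|Y-\Pi_{\mathcal S_*}Y\|^2/(n-p)$ (almost surely positive). The mixed estimator is $$\hat\mu=\sum_{m\in\mathcal M}w_m\hat\mu_m,\qquad w_m=\frac{\pi_m}{\mathcal Z}\exp\Big(\beta\frac{\|\hat\mu_m\|^2}{\hat\sigma^2}-L_m\Big),$$ where $\mathcal Z$ normalizes the sum of the $w_m$ to one. *)

theory Defs
  imports "HOL-Probability.Probability"
begin

definition std_gaussian_vector :: "'w measure \<Rightarrow> ('w \<Rightarrow> real ^ 'n) \<Rightarrow> bool" where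
  "std_gaussian_vector P \<epsilon> \<longleftrightarrow>
     prob_space P \<and>
     prob_space.indep_vars P (\<lambda>_. borel) (\<lambda>i \<omega>. \<epsilon> \<omega> $ i) UNIV \<and>
     (\<forall>i. distributed P lborel (\<lambda>\<omega>. \<epsilon> \<omega> $ i) std_normal_density)"

definition orthonormal_family :: "(nat \<Rightarrow> 'a::real_inner) \<Rightarrow> nat set \<Rightarrow> bool" where
  "orthonormal_family v J \<longleftrightarrow> (\<forall>i\<in>J. \<forall>j\<in>J. v i \<bullet> v j = (if i = j then 1 else 0))"

(* Meaningful when S is a linear subspace; existence and uniqueness of the
   described point are then given by orthogonal decomposition. *)
definition orth_proj :: "'a::euclidean_space set \<Rightarrow> 'a \<Rightarrow> 'a" where
  "orth_proj S x = (THE y. y \<in> S \<and> (\<forall>z\<in>S. orthogonal (x - y) z))"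

definition model_space :: "(nat \<Rightarrow> 'a::euclidean_space) \<Rightarrow> nat set \<Rightarrow> 'a set" where
  "model_space v m = span (v ` m)"

(* Estimators are functions of the observation y; evaluating them at Y \<omega> gives
   the corresponding random variables. *)
definition mu_hat :: "(nat \<Rightarrow> 'a::euclidean_space) \<Rightarrow> 'a \<Rightarrow> nat set \<Rightarrow> 'a" where
  "mu_hat v y m = orth_proj (model_space v m) y"

definition sigma_hat_sq :: "(nat \<Rightarrow> 'a::euclidean_space) \<Rightarrow> nat \<Rightarrow> 'a \<Rightarrow> real" where
  "sigma_hat_sq v p y =
     (norm (y - orth_proj (model_space v {1..p}) y))\<^sup>2 / (real DIM('a) - real p)"

definition raw_weight ::
  "(nat \<Rightarrow> 'a::euclidean_space) \<Rightarrow> nat \<Rightarrow> (nat set \<Rightarrow> real) \<Rightarrow> (nat set \<Rightarrow> real) \<Rightarrow> real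
    \<Rightarrow> 'a \<Rightarrow> nat set \<Rightarrow> real" where
  "raw_weight v p prior L \<beta> y m =
     prior m * exp (\<beta> * ((norm (mu_hat v y m))\<^sup>2 / sigma_hat_sq v p y) - L m)"

definition mix_weight ::
  "(nat \<Rightarrow> 'a::euclidean_space) \<Rightarrow> nat \<Rightarrow> (nat set \<Rightarrow> real) \<Rightarrow> (nat set \<Rightarrow> real) \<Rightarrow> real
    \<Rightarrow> 'a \<Rightarrow> nat set \<Rightarrow> real" where
  "mix_weight v p prior L \<beta> y m =
     raw_weight v p prior L \<beta> y m / (\<Sum>m'\<in>Pow {1..p}. raw_weight v p prior L \<beta> y m')"

definition mixed_estimator ::
  "(nat \<Rightarrow> 'a::euclidean_space) \<Rightarrow> nat \<Rightarrow> (nat set \<Rightarrow> real) \<Rightarrow> (nat set \<Rightarrow> real) \<Rightarrow> real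
    \<Rightarrow> 'a \<Rightarrow> 'a" where
  "mixed_estimator v p prior L \<beta> y =
     (\<Sum>m\<in>Pow {1..p}. mix_weight v p prior L \<beta> y m *\<^sub>R mu_hat v y m)"

end

theory Submission
  imports Defs
begin

text \<open>
  By orthonormality the squared norm of the projection of \<open>y\<close> onto a model space is
  \<open>\<Sum>j\<in>m. (y \<bullet> v j)\<^sup>2\<close>, so the unnormalized weight of \<open>m\<close> factorizes as a constant times
  \<open>\<Prod>j\<in>m. x j\<close>. Hence the normalizing sum is a product of the factors \<open>1 + x j\<close>, and the total
  weight of the models containing \<open>j\<close> is \<open>x j / (1 + x j)\<close>. The residual variance vanishes only
  if \<open>Y\<close> lies in a proper subspace; a nonzero normal vector \<open>a\<close> of that subspace makes
  \<open>a \<bullet> Y\<close> a nondegenerate Gaussian, which almost surely differs from zero.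
\<close>

section \<open>Orthogonal projection onto spans of orthonormal vectors\<close>

lemma orth_proj_eqI:
  assumes "subspace S" "y \<in> S" "\<And>z. z \<in> S \<Longrightarrow> orthogonal (x - y) z"
  shows "orth_proj S x = y"
  unfolding orth_proj_def
proof (rule the_equality)
  show "y \<in> S \<and> (\<forall>z\<in>S. orthogonal (x - y) z)"
    using assms by blast
next
  fix y' assume y': "y' \<in> S \<and> (\<forall>z\<in>S. orthogonal (x - y') z)"
  \<comment> \<open>The difference of two candidates lies in \<open>S\<close> and is orthogonal to
    itself, hence is zero.\<close>
  have "y - y' \<in> S"
    using assms y' subspace_diff by blast
  then have "(x - y') \<bullet> (y - y') = 0" "(x - y) \<bullet> (y - y') = 0"
    using assms y' by (auto simp: orthogonal_def)
  then have "(y - y') \<bullet> (y - y') = 0"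
    by (simp add: inner_diff_left)
  then show "y' = y"
    by simp
qed

lemma inner_orthonormal_sum:
  assumes "orthonormal_family v J" "finite m" "m \<subseteq> J" "k \<in> J"
  shows "(\<Sum>j\<in>m. c j *\<^sub>R v j) \<bullet> v k = (if k \<in> m then c k else 0)"
proof -
  have "(\<Sum>j\<in>m. c j *\<^sub>R v j) \<bullet> v k = (\<Sum>j\<in>m. if j = k then c j else 0)"
    unfolding inner_sum_left
  proof (rule sum.cong[OF refl])
    fix j assume "j \<in> m"
    then show "(c j *\<^sub>R v j) \<bullet> v k = (if j = k then c j else 0)"
      using assms unfolding orthonormal_family_def by auto
  qed
  then show ?thesis
    using assms(2) by simp
qed

lemma mu_hat_eq_sum:
  assumes "orthonormal_family v J" "finite m" "m \<subseteq> J"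
  shows "mu_hat v y m = (\<Sum>j\<in>m. (y \<bullet> v j) *\<^sub>R v j)"
  unfolding mu_hat_def model_space_def
proof (rule orth_proj_eqI)
  show "(\<Sum>j\<in>m. (y \<bullet> v j) *\<^sub>R v j) \<in> span (v ` m)"
    by (intro span_sum span_scale span_base) auto
next
  fix z assume "z \<in> span (v ` m)"
  then show "orthogonal (y - (\<Sum>j\<in>m. (y \<bullet> v j) *\<^sub>R v j)) z"
  proof (rule orthogonal_to_span)
    \<comment> \<open>By linearity only the generators matter, and there the sum reproduces the
      inner product of \<open>y\<close>.\<close>
    fix w assume "w \<in> v ` m"
    then show "orthogonal (y - (\<Sum>j\<in>m. (y \<bullet> v j) *\<^sub>R v j)) w"
      using assms inner_orthonormal_sum[OF assms, of _ "\<lambda>j. y \<bullet> v j"]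
      by (auto simp: orthogonal_def inner_diff_left)
  qed
qed (rule subspace_span)

lemma norm_mu_hat_sq:
  assumes "orthonormal_family v J" "finite m" "m \<subseteq> J"
  shows "(norm (mu_hat v y m))\<^sup>2 = (\<Sum>j\<in>m. (y \<bullet> v j)\<^sup>2)"
proof -
  let ?s = "\<Sum>j\<in>m. (y \<bullet> v j) *\<^sub>R v j"
  \<comment> \<open>Only the right factor is expanded, so that each remaining product with
    \<open>v j\<close> reads off one coefficient.\<close>
  have "?s \<bullet> ?s = (\<Sum>j\<in>m. (y \<bullet> v j) * (?s \<bullet> v j))"
    by (simp add: inner_sum_right)
  also have "\<dots> = (\<Sum>j\<in>m. (y \<bullet> v j)\<^sup>2)"
  proof (rule sum.cong[OF refl])
    fix j assume "j \<in> m"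
    then show "(y \<bullet> v j) * (?s \<bullet> v j) = (y \<bullet> v j)\<^sup>2"
      using inner_orthonormal_sum[OF assms, of j "\<lambda>j. y \<bullet> v j"] assms(3)
      by (auto simp: power2_eq_square)
  qed
  finally show ?thesis
    by (simp add: mu_hat_eq_sum[OF assms] power2_norm_eq_inner)
qed

section \<open>Subset sums of products and the model weights\<close>

lemma sum_Pow_prod:
  fixes x :: "'a \<Rightarrow> 'b::comm_semiring_1"
  assumes "finite J"
  shows "(\<Sum>m\<in>Pow J. \<Prod>i\<in>m. x i) = (\<Prod>i\<in>J. 1 + x i)"
  using prod_add[OF assms, of x "\<lambda>_. 1"] by (simp add: add.commute)

text \<open>The indicator of \<open>j \<in> m\<close> is itself a product over \<open>J - m\<close>,
  with factor 0 at \<open>j\<close> and 1 elsewhere. Expanding a product of binomials then applies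
  again, and the factor at \<open>j\<close> becomes \<open>x j + 0\<close>.\<close>

lemma sum_Pow_prod_containing:
  fixes x :: "'a \<Rightarrow> 'b::comm_semiring_1"
  assumes "finite J" "j \<in> J"
  shows "(\<Sum>m\<in>Pow J. if j \<in> m then \<Prod>i\<in>m. x i else 0) = x j * (\<Prod>i\<in>J - {j}. 1 + x i)"
proof -
  define y :: "'a \<Rightarrow> 'b" where "y i = (if i = j then 0 else 1)" for i
  have "(\<Sum>m\<in>Pow J. if j \<in> m then \<Prod>i\<in>m. x i else 0) =
      (\<Sum>m\<in>Pow J. (\<Prod>i\<in>m. x i) * (\<Prod>i\<in>J - m. y i))"
  proof (rule sum.cong[OF refl])
    fix m assume "m \<in> Pow J"
    have "(\<Prod>i\<in>J - m. y i) = (if j \<in> m then 1 else 0)"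
    proof (cases "j \<in> m")
      case True
      then show ?thesis by (auto simp: y_def intro!: prod.neutral)
    next
      case False
      then show ?thesis using assms by (auto simp: y_def intro!: prod_zero)
    qed
    then show "(if j \<in> m then \<Prod>i\<in>m. x i else 0) = (\<Prod>i\<in>m. x i) * (\<Prod>i\<in>J - m. y i)"
      by simp
  qed
  also have "\<dots> = (\<Prod>i\<in>J. x i + y i)"
    using prod_add[OF assms(1), of x y] by simp
  also have "\<dots> = x j * (\<Prod>i\<in>J - {j}. 1 + x i)"
    using assms by (subst prod.remove[of _ j]) (auto simp: y_def add.commute intro!: prod.cong)
  finally show ?thesis .
qed

text \<open>Exchanging the sums makes the coefficient of \<open>u j\<close> the total weight of the
  subsets containing \<open>j\<close>. The product over \<open>J - {j}\<close> cancels: indices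
  enter independently, with odds \<open>x j\<close>.\<close>

lemma product_weights_mixture:
  fixes u :: "'a \<Rightarrow> 'b::real_vector" and x :: "'a \<Rightarrow> real"
  assumes "finite J" and pos: "\<And>j. j \<in> J \<Longrightarrow> x j > 0"
  shows "(\<Sum>m\<in>Pow J. ((\<Prod>i\<in>m. x i) / (\<Sum>m'\<in>Pow J. \<Prod>i\<in>m'. x i)) *\<^sub>R (\<Sum>j\<in>m. u j)) =
    (\<Sum>j\<in>J. (x j / (1 + x j)) *\<^sub>R u j)"
proof -
  let ?D = "\<Prod>i\<in>J. 1 + x i"
  have "(\<Sum>m\<in>Pow J. ((\<Prod>i\<in>m. x i) / ?D) *\<^sub>R (\<Sum>j\<in>m. u j)) =
      (\<Sum>m\<in>Pow J. \<Sum>j\<in>J. ((if j \<in> m then \<Prod>i\<in>m. x i else 0) / ?D) *\<^sub>R u j)"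
  proof (rule sum.cong[OF refl])
    fix m assume m: "m \<in> Pow J"
    \<comment> \<open>The condition \<open>j \<in> m\<close> holds for every term here; it makes the
      terms added from \<open>J - m\<close> vanish, so the inner range no longer depends on
      \<open>m\<close>.\<close>
    have "((\<Prod>i\<in>m. x i) / ?D) *\<^sub>R (\<Sum>j\<in>m. u j) =
        (\<Sum>j\<in>m. ((if j \<in> m then \<Prod>i\<in>m. x i else 0) / ?D) *\<^sub>R u j)"
      by (simp add: scaleR_sum_right)
    also have "\<dots> = (\<Sum>j\<in>J. ((if j \<in> m then \<Prod>i\<in>m. x i else 0) / ?D) *\<^sub>R u j)"
      using m assms(1) by (intro sum.mono_neutral_left) auto
    finally show "((\<Prod>i\<in>m. x i) / ?D) *\<^sub>R (\<Sum>j\<in>m. u j) =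
        (\<Sum>j\<in>J. ((if j \<in> m then \<Prod>i\<in>m. x i else 0) / ?D) *\<^sub>R u j)" .
  qed
  also have "\<dots> = (\<Sum>j\<in>J. ((\<Sum>m\<in>Pow J. if j \<in> m then \<Prod>i\<in>m. x i else 0) / ?D) *\<^sub>R u j)"
    by (subst sum.swap) (simp add: scaleR_sum_left sum_divide_distrib)
  also have "\<dots> = (\<Sum>j\<in>J. (x j / (1 + x j)) *\<^sub>R u j)"
  proof (rule sum.cong[OF refl])
    fix j assume j: "j \<in> J"
    have "(\<Prod>i\<in>J - {j}. 1 + x i) > 0"
      using pos by (intro prod_pos) (auto simp: add_pos_pos)
    moreover have "?D = (1 + x j) * (\<Prod>i\<in>J - {j}. 1 + x i)"
      using assms(1) j by (rule prod.remove)
    ultimately show "((\<Sum>m\<in>Pow J. if j \<in> m then \<Prod>i\<in>m. x i else 0) / ?D) *\<^sub>R u j =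
        (x j / (1 + x j)) *\<^sub>R u j"
      using sum_Pow_prod_containing[OF assms(1) j, of x] by simp
  qed
  finally show ?thesis
    by (simp add: sum_Pow_prod[OF assms(1)])
qed

text \<open>The exponential turns the sum of squares into a product. Prior and penalty are powers
  with exponent \<open>card m\<close>, so each index of \<open>m\<close> takes one denominator
  \<open>p powr \<alpha> * exp b\<close>.\<close>

lemma raw_weight_eq_prod:
  assumes "orthonormal_family v {1..p}" "1 \<le> p" "m \<subseteq> {1..p}"
    and "prior m = C * real p powr (- \<alpha> * real (card m))" "L m = b * real (card m)"
  shows "raw_weight v p prior L \<beta> y m =
    C * (\<Prod>j\<in>m. exp (\<beta> * (y \<bullet> v j)\<^sup>2 / sigma_hat_sq v p y) / (real p powr \<alpha> * exp b))"
proof -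
  have fin: "finite m"
    using assms(3) finite_subset by blast
  have "exp (\<beta> * ((norm (mu_hat v y m))\<^sup>2 / sigma_hat_sq v p y) - L m) =
      (\<Prod>j\<in>m. exp (\<beta> * (y \<bullet> v j)\<^sup>2 / sigma_hat_sq v p y)) / exp b ^ card m"
    using fin assms
    by (simp add: norm_mu_hat_sq[OF assms(1) fin assms(3)] exp_diff exp_sum[symmetric]
        sum_distrib_left sum_divide_distrib mult.commute[of b] exp_of_nat_mult)
  moreover have "real p powr (- \<alpha> * real (card m)) = 1 / (real p powr \<alpha>) ^ card m"
    using assms(2) by (simp add: powr_minus powr_powr[symmetric] powr_realpow field_simps)
  ultimately show ?thesis
    by (simp add: raw_weight_def assms(4) prod_dividef power_mult_distrib)
qed

section \<open>Almost sure positivity of the variance estimator\<close>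

lemma std_gaussian_vector_AE_inner_neq:
  fixes \<epsilon> :: "'w \<Rightarrow> real ^ 'n" and a :: "real ^ 'n"
  assumes gauss: "std_gaussian_vector P \<epsilon>" and "a \<noteq> 0"
  shows "AE \<omega> in P. a \<bullet> \<epsilon> \<omega> \<noteq> t"
proof -
  interpret prob_space P
    using gauss by (simp add: std_gaussian_vector_def)
  \<comment> \<open>Coordinates with coefficient zero are dropped, since a normal law needs a positive variance.\<close>
  define I where "I = {i. a $ i \<noteq> 0}"
  have "I \<noteq> {}"
    using \<open>a \<noteq> 0\<close> by (auto simp: I_def vec_eq_iff)
  have "indep_vars (\<lambda>_. borel) (\<lambda>i \<omega>. \<epsilon> \<omega> $ i) I"
    using gauss by (auto simp: std_gaussian_vector_def intro: indep_vars_subset)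
  then have indep: "indep_vars (\<lambda>_. borel) (\<lambda>i \<omega>. a $ i * \<epsilon> \<omega> $ i) I"
    by (rule indep_vars_compose2[where Y = "\<lambda>i x. a $ i * x"]) auto
  have normal: "distributed P lborel (\<lambda>\<omega>. a $ i * \<epsilon> \<omega> $ i) (normal_density 0 \<bar>a $ i\<bar>)"
    if "i \<in> I" for i
    using normal_density_affine[of "\<lambda>\<omega>. \<epsilon> \<omega> $ i" 0 1 "a $ i" 0] gauss that
    by (simp add: std_gaussian_vector_def I_def)
  have "distributed P lborel (\<lambda>\<omega>. \<Sum>i\<in>I. a $ i * \<epsilon> \<omega> $ i)
      (normal_density (\<Sum>i\<in>I. 0) (sqrt (\<Sum>i\<in>I. \<bar>a $ i\<bar>\<^sup>2)))"
    using \<open>I \<noteq> {}\<close> indep normal by (intro sum_indep_normal) (auto simp: I_def)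
  moreover have "(\<Sum>i\<in>I. a $ i * \<epsilon> \<omega> $ i) = a \<bullet> \<epsilon> \<omega>" for \<omega>
    unfolding inner_vec_def I_def by (intro sum.mono_neutral_cong_left) auto
  \<comment> \<open>Only the existence of a density is kept: it rules out an atom at
    \<open>t\<close>.\<close>
  ultimately obtain f where "distributed P lborel (\<lambda>\<omega>. a \<bullet> \<epsilon> \<omega>) f"
    by auto
  then have "(AE \<omega> in P. a \<bullet> \<epsilon> \<omega> \<noteq> t) \<longleftrightarrow> (AE x in lborel. 0 < f x \<longrightarrow> x \<noteq> t)"
    by (rule distributed_AE2) auto
  then show ?thesis
    using AE_lborel_singleton[of t] by auto
qed

lemma sigma_hat_sq_posI:
  fixes v :: "nat \<Rightarrow> 'a::euclidean_space"
  assumes "orthonormal_family v {1..p}" "p < DIM('a)" "y \<notin> span (v ` {1..p})"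
  shows "sigma_hat_sq v p y > 0"
proof -
  have "mu_hat v y {1..p} \<in> span (v ` {1..p})"
    unfolding mu_hat_eq_sum[OF assms(1) finite_atLeastAtMost subset_refl]
    by (intro span_sum span_scale span_base) auto
  then have "y \<noteq> mu_hat v y {1..p}"
    using assms(3) by auto
  then show ?thesis
    using assms(2) by (simp add: sigma_hat_sq_def mu_hat_def)
qed

lemma AE_sigma_hat_sq_pos:
  fixes v :: "nat \<Rightarrow> real ^ 'n"
  assumes "orthonormal_family v {1..p}" "p < CARD('n)"
    and "std_gaussian_vector P \<epsilon>" "\<sigma> \<noteq> 0"
  shows "AE \<omega> in P. sigma_hat_sq v p (\<mu> + \<sigma> *\<^sub>R \<epsilon> \<omega>) > 0"
proof -
  \<comment> \<open>At most \<open>p\<close> generators cannot span the whole space, so their span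
    lies in a hyperplane.\<close>
  have "dim (v ` {1..p}) \<le> card (v ` {1..p})"
    by (rule dim_le_card') simp
  also have "\<dots> \<le> p"
    using card_image_le[of "{1..p}" v] by simp
  finally have "dim (v ` {1..p}) < DIM(real ^ 'n)"
    using assms(2) by simp
  then obtain a where a: "a \<noteq> 0" "span (v ` {1..p}) \<subseteq> {x. a \<bullet> x = 0}"
    using lowdim_subset_hyperplane by blast
  \<comment> \<open>This is the value of \<open>a \<bullet> \<epsilon> \<omega>\<close> at which the
    shifted and scaled vector would meet the hyperplane.\<close>
  have "AE \<omega> in P. a \<bullet> \<epsilon> \<omega> \<noteq> - (a \<bullet> \<mu>) / \<sigma>"
    using assms(3) a(1) by (rule std_gaussian_vector_AE_inner_neq)
  then show ?thesis
  proof eventually_elim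
    case (elim \<omega>)
    then have "a \<bullet> (\<mu> + \<sigma> *\<^sub>R \<epsilon> \<omega>) \<noteq> 0"
      using assms(4) by (auto simp: inner_add_right field_simps add_eq_0_iff)
    then show ?case
      using a(2) assms(1,2) by (intro sigma_hat_sq_posI) auto
  qed
qed

section \<open>The shrinkage formula\<close>

lemma mixed_estimator_eq_shrinkage:
  fixes v :: "nat \<Rightarrow> 'a::euclidean_space" and \<beta> :: real
  assumes orth: "orthonormal_family v {1..p}" and "1 \<le> p" and "C > 0"
    and prior: "\<And>m. m \<in> Pow {1..p} \<Longrightarrow> prior m = C * real p powr (- \<alpha> * real (card m))"
    and L: "\<And>m. m \<in> Pow {1..p} \<Longrightarrow> L m = b * real (card m)"
  defines "e \<equiv> \<lambda>y j. exp (\<beta> * (y \<bullet> v j)\<^sup>2 / sigma_hat_sq v p y)"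
  shows "mixed_estimator v p prior L \<beta> y =
    (\<Sum>j = 1..p. (e y j / (real p powr \<alpha> * exp b + e y j) * (y \<bullet> v j)) *\<^sub>R v j)"
proof -
  define x where "x j = e y j / (real p powr \<alpha> * exp b)" for j
  have q: "real p powr \<alpha> * exp b > 0"
    using \<open>1 \<le> p\<close> by simp
  have x_pos: "x j > 0" for j
    using q by (simp add: x_def e_def)
  have ratio: "x j / (1 + x j) = e y j / (real p powr \<alpha> * exp b + e y j)" for j
  proof -
    have "1 + x j = (real p powr \<alpha> * exp b + e y j) / (real p powr \<alpha> * exp b)"
      using \<open>1 \<le> p\<close> by (simp add: x_def add_divide_distrib)
    then show ?thesis
      using \<open>1 \<le> p\<close> by (simp add: x_def)
  qed
  have raw: "raw_weight v p prior L \<beta> y m = C * (\<Prod>j\<in>m. x j)" if "m \<in> Pow {1..p}" for m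
    using raw_weight_eq_prod[of v p m prior C \<alpha> L b \<beta> y] that orth \<open>1 \<le> p\<close> prior L
    by (simp add: x_def e_def)
  have "mixed_estimator v p prior L \<beta> y =
      (\<Sum>m\<in>Pow {1..p}. ((\<Prod>i\<in>m. x i) / (\<Sum>m'\<in>Pow {1..p}. \<Prod>i\<in>m'. x i)) *\<^sub>R
        (\<Sum>j\<in>m. (y \<bullet> v j) *\<^sub>R v j))"
    unfolding mixed_estimator_def
  proof (rule sum.cong[OF refl])
    fix m assume m: "m \<in> Pow {1..p}"
    then have "finite m"
      using finite_subset by auto
    \<comment> \<open>\<open>C\<close> factors out of the normalizer too and cancels in the ratio,
      being nonzero.\<close>
    have "(\<Sum>m'\<in>Pow {1..p}. raw_weight v p prior L \<beta> y m') =
        C * (\<Sum>m'\<in>Pow {1..p}. \<Prod>i\<in>m'. x i)"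
      using raw by (simp add: sum_distrib_left)
    then have "mix_weight v p prior L \<beta> y m =
        (\<Prod>i\<in>m. x i) / (\<Sum>m'\<in>Pow {1..p}. \<Prod>i\<in>m'. x i)"
      using raw[OF m] \<open>C > 0\<close> by (simp add: mix_weight_def)
    then show "mix_weight v p prior L \<beta> y m *\<^sub>R mu_hat v y m =
        ((\<Prod>i\<in>m. x i) / (\<Sum>m'\<in>Pow {1..p}. \<Prod>i\<in>m'. x i)) *\<^sub>R (\<Sum>j\<in>m. (y \<bullet> v j) *\<^sub>R v j)"
      using mu_hat_eq_sum[OF orth \<open>finite m\<close>] m by simp
  qed
  also have "\<dots> = (\<Sum>j = 1..p. (x j / (1 + x j)) *\<^sub>R ((y \<bullet> v j) *\<^sub>R v j))"
    using x_pos by (intro product_weights_mixture) auto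
  finally show ?thesis
    by (simp add: ratio)
qed

theorem proposition1:
  fixes P :: "'w measure"
    and v :: "nat \<Rightarrow> real ^ 'n"
    and \<mu> :: "real ^ 'n"
    and \<epsilon> Y :: "'w \<Rightarrow> real ^ 'n"
    and p :: nat
    and \<sigma> \<alpha> b \<beta> :: real
    and prior L :: "nat set \<Rightarrow> real"
  assumes "CARD('n) \<ge> 3" and "1 \<le> p" and "p < CARD('n)"
    and "orthonormal_family v {1..p}"
    and "std_gaussian_vector P \<epsilon>" and "\<sigma> > 0"
    and "\<And>\<omega>. \<omega> \<in> space P \<Longrightarrow> Y \<omega> = \<mu> + \<sigma> *\<^sub>R \<epsilon> \<omega>"
    and "\<alpha> > 0" and "b \<ge> 0" and "\<beta> > 0"
    and "\<And>m. m \<in> Pow {1..p} \<Longrightarrow>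
           prior m = (1 + 1 / real p powr \<alpha>) powr (- real p) * real p powr (- \<alpha> * real (card m))"
    and "\<And>m. m \<in> Pow {1..p} \<Longrightarrow> L m = b * real (card m)"
  shows "(AE \<omega> in P. sigma_hat_sq v p (Y \<omega>) > 0) \<and>
    (\<forall>\<omega>\<in>space P. sigma_hat_sq v p (Y \<omega>) > 0 \<longrightarrow>
      (let Z = (\<lambda>j. Y \<omega> \<bullet> v j);
           s2 = sigma_hat_sq v p (Y \<omega>);
           c = (\<lambda>j. exp (\<beta> * (Z j)\<^sup>2 / s2) / (real p powr \<alpha> * exp b + exp (\<beta> * (Z j)\<^sup>2 / s2)))
       in mixed_estimator v p prior L \<beta> (Y \<omega>) = (\<Sum>j = 1..p. (c j * Z j) *\<^sub>R v j)))"
proof -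
  have "AE \<omega> in P. sigma_hat_sq v p (\<mu> + \<sigma> *\<^sub>R \<epsilon> \<omega>) > 0"
    using assms by (intro AE_sigma_hat_sq_pos) auto
  \<comment> \<open>\<open>Y\<close> is prescribed on \<open>space P\<close> only, hence the appeal
    to \<open>AE_space\<close>.\<close>
  then have "AE \<omega> in P. sigma_hat_sq v p (Y \<omega>) > 0"
    using AE_space by eventually_elim (simp add: assms(7))
  \<comment> \<open>Positivity of the base gives positivity of the prior's constant, which serves as
    \<open>C\<close>.\<close>
  moreover have "1 + 1 / real p powr \<alpha> > 0"
    by (simp add: add_pos_nonneg)
  then have "(1 + 1 / real p powr \<alpha>) powr (- real p) > 0"
    by simp
  ultimately show ?thesis
    using mixed_estimator_eq_shrinkage[OF assms(4,2) _ assms(11,12)]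
    by (simp add: Let_def)
qed

end
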